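(* Let $R$ be a based ring such that $\mathrm{FPdim}(R)\in\mathbb{Z}$. Then there is an elementary abelian $2$-group $E$, a set of distinct square free positive integers $n_x$, $x\in E$, with $n_0=1$ (where $0$ is the identity element of $E$), and a faithful grading $R=\bigoplus_{x\in E}R(n_x)$ of $R$ by $E$ (with component $R(n_x)$ in degree $x$) such that $\mathrm{FPdim}(X)\in\mathbb{Z}\sqrt{n_x}$ for each $X\in R(n_x)$.
   Context: A based ring is a pair $(R,B)$ where $R$ is a ring with identity, free of finite rank as a $\mathbb{Z}$-module, and $B=\{X_i\}_{i\in\mathcal{I}}$ is a $\mathbb{Z}$-basis of $R$ (its elements are called basic) such that $X_iX_j=\sum_{k}c_{ij}^kX_k$ with all $c_{ij}^k$ non-negative integers, the identity $1$ belongs to $B$ (all based rings are unital), and there is an involution $i\mapsto i^*$ of $\mathcal{I}$ whose induced map $X=\sum a_iX_i\mapsto X^*=\sum a_iX_{i^*}$ satisfies $(XY,Z)=(X,ZY^* )=(Y,X^*Z)$ for all $X,Y,Z\in R$, where $(\sum a_iX_i,\sum b_iX_i)=\sum a_ib_i$. $\mathrm{FPdim}:R\to\mathbb{R}$ is the unique ring homomorphism sending every basic element to a positive number (for a basic element $X$ it is the largest positive eigenvalue of the matrix of multiplication by $X$ in the basis $B$), and $\mathrm{FPdim}(R)=\sum_{i\in\mathcal{I}}\mathrm{FPdim}(X_i)^2$. A grading of $(R,B)$ by a finite group $G$ is a partition $B=\bigcup_{g\in G}B_g$ such that, with $R_g$ the $\mathbb{Z}$-span of $B_g$, one has $R=\bigoplus_g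 R_g$, $R_gR_h\subset R_{gh}$ and $R_g^*=R_{g^{-1}}$ for all $g,h\in G$. It is faithful if $R_g\neq0$ for all $g\in G$. *)

theory Defs
  imports
    Complex_Main
    "HOL-Algebra.Algebra"
    "HOL-Algebra.Algebraic_Closure_Type"
    "HOL-Computational_Algebra.Squarefree"
begin

section \<open>Integer combinations and coordinates\<close>

definition int_comb :: "('a, 'm) ring_scheme \<Rightarrow> 'a set \<Rightarrow> ('a \<Rightarrow> int) \<Rightarrow> 'a"
  where "int_comb R S a = (\<Oplus>\<^bsub>R\<^esub>b\<in>S. add_pow R (a b) b)"

definition int_span :: "('a, 'm) ring_scheme \<Rightarrow> 'a set \<Rightarrow> 'a set"
  where "int_span R S = range (int_comb R S)"

text \<open>
  Coefficient functions are taken in \<^term>\<open>extensional B\<close>, since their values outside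
  the basis are irrelevant to the combination and would spoil uniqueness.
\<close>

definition is_int_basis :: "('a, 'm) ring_scheme \<Rightarrow> 'a set \<Rightarrow> bool"
  where "is_int_basis R B \<longleftrightarrow> finite B \<and> B \<subseteq> carrier R \<and>
    (\<forall>x\<in>carrier R. \<exists>!a. a \<in> extensional B \<and> x = int_comb R B a)"

definition coord :: "('a, 'm) ring_scheme \<Rightarrow> 'a set \<Rightarrow> 'a \<Rightarrow> 'a \<Rightarrow> int"
  where "coord R B x = (THE a. a \<in> extensional B \<and> x = int_comb R B a)"

definition basis_form :: "('a, 'm) ring_scheme \<Rightarrow> 'a set \<Rightarrow> 'a \<Rightarrow> 'a \<Rightarrow> int"
  where "basis_form R B x y = (\<Sum>b\<in>B. coord R B x b * coord R B y b)"

section \<open>Based rings\<close>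

text \<open>
  The basis is indexed by itself, so the involution \<open>i \<mapsto> i*\<close> of the index set is a map
  \<open>star\<close> on \<open>B\<close>; \<open>invol\<close> is the induced additive map on the whole ring.
\<close>

definition invol :: "('a, 'm) ring_scheme \<Rightarrow> 'a set \<Rightarrow> ('a \<Rightarrow> 'a) \<Rightarrow> 'a \<Rightarrow> 'a"
  where "invol R B star x = (\<Oplus>\<^bsub>R\<^esub>b\<in>B. add_pow R (coord R B x b) (star b))"

locale based_ring = ring R for R :: "('a, 'm) ring_scheme" (structure) +
  fixes B :: "'a set" and star :: "'a \<Rightarrow> 'a"
  assumes basis: "is_int_basis R B"
    and one_basic: "\<one> \<in> B"
    and structure_constants_nonneg:
      "\<lbrakk>x \<in> B; y \<in> B; z \<in> B\<rbrakk> \<Longrightarrow> 0 \<le> coord R B (x \<otimes> y) z"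
    and star_basic: "x \<in> B \<Longrightarrow> star x \<in> B"
    and star_star: "x \<in> B \<Longrightarrow> star (star x) = x"
    and form_right:
      "\<lbrakk>x \<in> carrier R; y \<in> carrier R; z \<in> carrier R\<rbrakk>
        \<Longrightarrow> basis_form R B (x \<otimes> y) z = basis_form R B x (z \<otimes> invol R B star y)"
    and form_left:
      "\<lbrakk>x \<in> carrier R; y \<in> carrier R; z \<in> carrier R\<rbrakk>
        \<Longrightarrow> basis_form R B (x \<otimes> y) z = basis_form R B y (invol R B star x \<otimes> z)"

section \<open>Frobenius--Perron dimension\<close>

text \<open>
  \<^term>\<open>ring_of_type_algebra :: real ring\<close> is the field of real numbers as a ring record;
  \<^term>\<open>extensional (carrier R)\<close> makes the homomorphism unique as a total function.
\<close>

definition FPdim :: "('a, 'm) ring_scheme \<Rightarrow> 'a set \<Rightarrow> 'a \<Rightarrow> real"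
  where "FPdim R B = (THE f. f \<in> extensional (carrier R) \<and>
    f \<in> ring_hom R (ring_of_type_algebra :: real ring) \<and> (\<forall>b\<in>B. f b > 0))"

definition FPdim_ring :: "('a, 'm) ring_scheme \<Rightarrow> 'a set \<Rightarrow> real"
  where "FPdim_ring R B = (\<Sum>b\<in>B. (FPdim R B b)\<^sup>2)"

section \<open>Gradings\<close>

definition elementary_abelian_2_group :: "('g, 'n) monoid_scheme \<Rightarrow> bool"
  where "elementary_abelian_2_group E \<longleftrightarrow>
    comm_group E \<and> (\<forall>x\<in>carrier E. x \<otimes>\<^bsub>E\<^esub> x = \<one>\<^bsub>E\<^esub>)"

text \<open>
  A grading is given by the parts \<open>C g\<close> of the basis, some of which may be empty; its
  homogeneous component of degree \<open>g\<close> is \<^term>\<open>int_span R (C g)\<close>.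
\<close>

definition is_grading ::
  "('a, 'm) ring_scheme \<Rightarrow> 'a set \<Rightarrow> ('a \<Rightarrow> 'a) \<Rightarrow> ('g, 'n) monoid_scheme \<Rightarrow> ('g \<Rightarrow> 'a set) \<Rightarrow> bool"
  where "is_grading R B star G C \<longleftrightarrow>
    group G \<and> finite (carrier G) \<and>
    (\<Union>g\<in>carrier G. C g) = B \<and> disjoint_family_on C (carrier G) \<and>
    (\<forall>x\<in>carrier R. \<exists>!u. u \<in> (\<Pi>\<^sub>E g\<in>carrier G. int_span R (C g)) \<and>
      x = (\<Oplus>\<^bsub>R\<^esub>g\<in>carrier G. u g)) \<and>
    (\<forall>g\<in>carrier G. \<forall>h\<in>carrier G. \<forall>x\<in>int_span R (C g). \<forall>y\<in>int_span R (C h).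
      x \<otimes>\<^bsub>R\<^esub> y \<in> int_span R (C (g \<otimes>\<^bsub>G\<^esub> h))) \<and>
    (\<forall>g\<in>carrier G. invol R B star ` int_span R (C g) = int_span R (C (inv\<^bsub>G\<^esub> g)))"

definition faithful_grading ::
  "('a, 'm) ring_scheme \<Rightarrow> 'a set \<Rightarrow> ('a \<Rightarrow> 'a) \<Rightarrow> ('g, 'n) monoid_scheme \<Rightarrow> ('g \<Rightarrow> 'a set) \<Rightarrow> bool"
  where "faithful_grading R B star G C \<longleftrightarrow>
    is_grading R B star G C \<and> (\<forall>g\<in>carrier G. int_span R (C g) \<noteq> {\<zero>\<^bsub>R\<^esub>})"

end

theory Submission
  imports Defs "HOL-Analysis.Function_Topology"
begin

text \<open>
  Write \<open>d\<close> for the Frobenius--Perron dimension and \<open>D = (\<Sum>b\<in>B. (d b)\<^sup>2)\<close> for the dimension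
  of the ring, which is assumed to be an integer.

  The element \<open>Z = (\<Sum>b\<in>B. b b*)\<close> has dimension \<open>D\<close>, because \<open>d (b*) = d b\<close>. Right
  multiplication by \<open>Z\<close> is a symmetric non-negative integer matrix, and \<open>d\<close> is an eigenfunctional
  for its integer eigenvalue \<open>D\<close> that is positive on the basis. Call two basic elements
  \<open>x\<close> and \<open>y\<close> linked if the corresponding matrix entry is positive; by Frobenius reciprocity
  this says that \<open>x b\<close> and \<open>y b\<close> share a constituent for some basic \<open>b\<close>. On a connected
  component of this relation the matrix is irreducible, so there the eigenfunctionals for \<open>D\<close> are
  all proportional to \<open>d\<close>. Now choose a \<open>\<rat>\<close>-linear retraction \<open>\<phi>\<close> of \<open>\<real>\<close> onto \<open>\<rat>\<close>.
  As \<open>D\<close> and the matrix entries are integers, \<open>z \<mapsto> \<phi> (d z / d x)\<close> is again an eigenfunctional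
  for \<open>D\<close>, it takes rational values, and it is \<open>1\<close> at \<open>x\<close>. It therefore coincides with
  \<open>d z / d x\<close> on the component of \<open>x\<close>: dimensions in one component have rational ratios
  (\<open>FPdim_ratio_rational\<close>). This argument replaces the usual one with Galois conjugates.

  Two consequences give the theorem. The constituents of \<open>b b*\<close> lie in the component of \<open>1\<close>, where
  \<open>d\<close> is rational; multiplication by \<open>(d b)\<^sup>2\<close> preserves the finitely generated group spanned by
  the dimensions of that component, so \<open>(d b)\<^sup>2\<close> is an integer (\<open>FPdim_square_integral\<close>) and
  \<open>d b\<close> is an integer multiple of \<open>sqrt n\<close>, where the radicand \<open>n\<close> is the squarefree part of
  \<open>(d b)\<^sup>2\<close>. Moreover any two constituents of a product \<open>b c\<close> are linked, so \<open>d b * d c\<close> is a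
  rational multiple of \<open>d k\<close> for each constituent \<open>k\<close>, and the radicand of \<open>k\<close> is the squarefree
  part of the product of the radicands of \<open>b\<close> and \<open>c\<close> (\<open>radicand_constituent\<close>). Hence the
  radicands form an elementary abelian 2-group, and sorting the basis by radicand is the desired
  grading.

  Beforehand \<open>d\<close> has to be constructed, since it is given by a definite description. The sum of the
  basis acts by a strictly positive matrix, whose Perron eigenvector yields a positive character
  (\<open>positive_character_exists\<close>); comparing the largest ratio of two positive characters shows that
  there is only one (\<open>positive_character_le\<close>).
\<close>

section \<open>Additive maps and rationality\<close>

lemma additive_int_multiple:
  fixes f :: "'b::ring_1 \<Rightarrow> 'c::ring_1"
  assumes "\<And>x y. f (x + y) = f x + f y"
  shows "f (of_int k * x) = of_int k * f x"
proof -
  interpret additive f by standard (rule assms)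
  have nat: "f (of_nat n * x) = of_nat n * f x" for n
    by (induction n) (simp_all add: zero add algebra_simps)
  show ?thesis
    using nat by (cases k rule: int_diff_cases) (simp add: left_diff_distrib diff)
qed

text \<open>
  The inclusion of \<open>\<rat>\<close> into \<open>\<real>\<close> splits over \<open>\<rat>\<close>, as every injective linear map does.
\<close>

lemma additive_rational_retraction:
  obtains \<phi> :: "real \<Rightarrow> real"
  where "\<And>x y. \<phi> (x + y) = \<phi> x + \<phi> y" "\<phi> 1 = 1" "\<And>x. \<phi> x \<in> \<rat>"
proof -
  interpret vector_space_pair "(*) :: rat \<Rightarrow> rat \<Rightarrow> rat" "\<lambda>(r :: rat) (x :: real). of_rat r * x"
    by unfold_locales (simp_all add: algebra_simps of_rat_add of_rat_mult)
  have "Vector_Spaces.linear (*) (\<lambda>r x. of_rat r * x) (of_rat :: rat \<Rightarrow> real)"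
    by unfold_locales (simp_all add: of_rat_add of_rat_mult)
  from linear_injective_left_inverse[OF this]
  obtain g where g: "Vector_Spaces.linear (\<lambda>(r :: rat) (x :: real). of_rat r * x) (*) g" "g \<circ> of_rat = id"
    by (auto simp: inj_on_def)
  interpret g: Vector_Spaces.linear "\<lambda>(r :: rat) (x :: real). of_rat r * x" "(*)" g by (rule g)
  have "g 1 = 1"
    using fun_cong[OF g(2), of 1] by simp
  then show thesis
    by (intro that[of "\<lambda>x. of_rat (g x)"]) (simp_all add: g.add of_rat_add)
qed

lemma finite_common_denominator:
  fixes f :: "'b \<Rightarrow> real"
  assumes "finite S" "\<And>x. x \<in> S \<Longrightarrow> f x \<in> \<rat>"
  obtains N :: nat where "N > 0" "\<And>x. x \<in> S \<Longrightarrow> real N * f x \<in> \<int>"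
proof -
  have "\<exists>N>0. \<forall>x\<in>S. real N * f x \<in> \<int>"
    using assms
  proof (induction rule: finite_induct)
    case empty
    then show ?case by auto
  next
    case (insert y S)
    then obtain N where N: "N > 0" "\<forall>x\<in>S. real N * f x \<in> \<int>" by auto
    have "f y \<in> \<rat>" using insert by simp
    then obtain a b where ab: "b > 0" "f y = of_int a / of_int b"
      by (rule Rats_cases')
    define M where "M = nat b"
    have M: "M > 0" "real M * f y \<in> \<int>"
      using ab by (simp_all add: M_def)
    have "real (M * N) * f y \<in> \<int>"
      using Ints_mult[OF Ints_of_nat[of N] M(2)] by (simp only: of_nat_mult mult_ac)
    moreover have "real (M * N) * f x \<in> \<int>" if "x \<in> S" for x
      using Ints_mult[OF Ints_of_nat[of M] N(2)[rule_format, OF that]]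
      by (simp only: of_nat_mult mult_ac)
    ultimately show ?case
      using M N by (intro exI[of _ "M * N"]) auto
  qed
  then show thesis using that by blast
qed

text \<open>
  If \<open>q = a / b\<close> in lowest terms, the hypothesis forces \<open>b ^ n\<close> to divide \<open>N\<close> for every
  \<open>n\<close>. This is integral closedness of \<open>\<int>\<close> in a form that needs no monic polynomial for \<open>q\<close>.
\<close>

lemma rational_bounded_denominator_powers:
  fixes q :: real
  assumes "q \<in> \<rat>" "N > 0" "\<And>n. real N * q ^ n \<in> \<int>"
  shows "q \<in> \<int>"
proof -
  from \<open>q \<in> \<rat>\<close> obtain a b :: int where ab: "b > 0" "coprime a b" "q = of_int a / of_int b"
    by (rule Rats_cases')
  have dvd: "b ^ n dvd int N" for n
  proof -
    obtain m where "real N * q ^ n = of_int m"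
      using assms(3) by (auto elim: Ints_cases)
    then have "of_int (int N * a ^ n) = (of_int (b ^ n * m) :: real)"
      using ab by (simp add: field_simps)
    then have "b ^ n dvd int N * a ^ n"
      by (metis of_int_eq_iff dvd_triv_left)
    then show ?thesis
      using ab(2) by (simp add: coprime_commute coprime_dvd_mult_left_iff)
  qed
  have "b = 1"
  proof (rule ccontr)
    assume "b \<noteq> 1"
    then have "2 \<le> b" using ab by simp
    then have "int 2 ^ N \<le> b ^ N" by (intro power_mono) auto
    moreover have "b ^ N \<le> int N"
      using dvd[of N] assms(2) by (auto intro: zdvd_imp_le)
    ultimately have "2 ^ N \<le> N"
      by (metis of_nat_le_iff of_nat_power order_trans)
    then show False
      using less_exp[of N] by simp
  qed
  then show ?thesis using ab by simp
qed

section \<open>Squarefree parts and square classes\<close>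

lemma squarefree_part_square_mult:
  fixes u m :: nat
  assumes "u > 0"
  shows "squarefree_part (u\<^sup>2 * m) = squarefree_part m"
proof (cases "m = 0")
  case False
  show ?thesis
  proof (rule multiplicity_eq_nat)
    fix p :: nat assume p: "normalization_semidom_class.prime p"
    have "multiplicity p (u\<^sup>2 * m) = 2 * multiplicity p u + multiplicity p m"
      using p assms False
      by (simp add: prime_elem_multiplicity_mult_distrib prime_elem_multiplicity_power_distrib)
    then show "multiplicity p (squarefree_part (u\<^sup>2 * m)) = multiplicity p (squarefree_part m)"
      using p by (simp add: prime_multiplicity_squarefree_part)
  qed (auto intro!: gr0I)
qed simp

lemma squarefree_part_mult_left:
  fixes a b :: nat
  assumes "a > 0"
  shows "squarefree_part (squarefree_part a * b) = squarefree_part (a * b)"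
proof -
  have "a * b = (square_part a)\<^sup>2 * (squarefree_part a * b)"
    using squarefree_decompose[of a] by (metis mult.assoc mult.commute)
  moreover have "square_part a > 0"
    using assms by (auto intro!: gr0I)
  ultimately show ?thesis
    using squarefree_part_square_mult[of "square_part a" "squarefree_part a * b"] by (simp only:)
qed

lemma squarefree_part_eq_if_rational_square_multiple:
  fixes p q :: nat and r :: real
  assumes "p > 0" "r \<in> \<rat>" "real p = r\<^sup>2 * real q"
  shows "squarefree_part p = squarefree_part q"
proof -
  from \<open>r \<in> \<rat>\<close> obtain a b :: nat where ab: "b \<noteq> 0" "\<bar>r\<bar> = real a / real b"
    by (rule Rats_abs_nat_div_natE)
  have "r\<^sup>2 = (real a / real b)\<^sup>2"
    using ab(2) by (metis power2_abs)
  then have "real (b\<^sup>2 * p) = real (a\<^sup>2 * q)"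
    using ab(1) assms(3) by (simp add: field_simps)
  then have eq: "b\<^sup>2 * p = a\<^sup>2 * q"
    by (rule of_nat_eq_iff[THEN iffD1])
  then have "a \<noteq> 0"
    using ab(1) assms(1) by (intro notI) simp
  then show ?thesis
    using eq ab(1) squarefree_part_square_mult[of b p] squarefree_part_square_mult[of a q] by simp
qed

section \<open>Perron eigenvectors of positive matrices\<close>

text \<open>
  Collatz--Wielandt argument: among the vectors of the standard simplex choose one that
  satisfies \<open>r w \<le> A w\<close> with the largest possible \<open>r\<close>. If the inequality were strict in some
  coordinate, then \<open>A w\<close> would satisfy it strictly in all coordinates and would admit a larger \<open>r\<close>.
\<close>

lemma positive_matrix_eigenvector:
  fixes A :: "'b \<Rightarrow> 'b \<Rightarrow> real"
  assumes fin: "finite I" and ne: "I \<noteq> {}" and pos: "\<And>i j. i \<in> I \<Longrightarrow> j \<in> I \<Longrightarrow> A i j > 0"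
  obtains w r where "\<And>i. i \<in> I \<Longrightarrow> w i > 0" "\<And>i. i \<in> I \<Longrightarrow> (\<Sum>j\<in>I. A i j * w j) = r * w i"
proof -
  (* Coordinates run over the whole type, so that Tychonoff's theorem applies to the euclidean
     topology of the function space; the coordinates outside I are arbitrary in the unit interval. *)
  define K :: "('b \<Rightarrow> real) set" where "K = (\<Pi>\<^sub>E i\<in>UNIV. {0..1})"
  define L where "L = (\<Sum>i\<in>I. \<Sum>j\<in>I. A i j)"
  define T where "T = {p \<in> K \<times> {0..L}. (\<Sum>i\<in>I. fst p i) = 1 \<and>
      (\<forall>i\<in>I. snd p * fst p i \<le> (\<Sum>j\<in>I. A i j * fst p j))}"
  have "compactin euclidean K"
    unfolding K_def euclidean_product_topology[symmetric] compactin_PiE by simp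
  then have KL: "compact (K \<times> {0..L})"
    by (intro compact_Times) auto
  have T_eq: "T = (K \<times> {0..L}) \<inter> ({p. (\<Sum>i\<in>I. fst p i) = 1} \<inter>
      (\<Inter>i\<in>I. {p. snd p * fst p i \<le> (\<Sum>j\<in>I. A i j * fst p j)}))"
    using ne by (auto simp: T_def)
  have coord: "continuous_on UNIV (\<lambda>p :: ('b \<Rightarrow> real) \<times> real. fst p i)" for i
    by (rule continuous_on_product_then_coordinatewise) (intro continuous_intros)
  have closed: "closed ({p. (\<Sum>i\<in>I. fst p i) = 1} \<inter>
      (\<Inter>i\<in>I. {p :: ('b \<Rightarrow> real) \<times> real. snd p * fst p i \<le> (\<Sum>j\<in>I. A i j * fst p j)}))"
    by (intro closed_Int closed_INT ballI closed_Collect_eq closed_Collect_le continuous_intros coord)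
  have compact: "compact T"
    unfolding T_eq by (rule compact_Int_closed[OF KL closed])
  have L0: "L \<ge> 0"
    using pos by (auto simp: L_def less_imp_le intro!: sum_nonneg)
  define e where "e = (\<lambda>i. if i \<in> I then 1 / real (card I) else 0)"
  have "card I > 0"
    using fin ne by (simp add: card_gt_0_iff)
  then have "(e, 0) \<in> T"
    using L0 pos fin ne by (auto simp: T_def K_def e_def less_imp_le intro!: sum_nonneg)
  then obtain p where p: "p \<in> T" "\<And>q. q \<in> T \<Longrightarrow> snd q \<le> snd p"
    using continuous_attains_sup[OF compact, of snd] by (force intro: continuous_intros)
  define w r where "w = fst p" and "r = snd p"
  have w0: "w i \<ge> 0" for i
    using p(1) by (auto simp: T_def K_def w_def PiE_def Pi_def)
  have w1: "(\<Sum>i\<in>I. w i) = 1" and ge: "\<And>i. i \<in> I \<Longrightarrow> r * w i \<le> (\<Sum>j\<in>I. A i j * w j)" and r0: "r \<ge> 0"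
    using p(1) by (auto simp: T_def w_def r_def)
  have Aw_pos: "(\<Sum>j\<in>I. A i j * v j) > 0"
    if "i \<in> I" "\<And>j. j \<in> I \<Longrightarrow> v j \<ge> 0" "k \<in> I" "v k > 0" for i k v
    using that fin pos by (intro sum_pos2[of _ k]) (auto simp: less_imp_le)
  obtain k where k: "k \<in> I" "w k > 0"
    using w1 w0 by (metis less_eq_real_def sum.neutral zero_neq_one)
  define v where "v = (\<lambda>i. \<Sum>j\<in>I. A i j * w j)"
  have v_pos: "v i > 0" if "i \<in> I" for i
    unfolding v_def using that w0 k by (intro Aw_pos)
  have eq: "v i = r * w i" if i: "i \<in> I" for i
  proof (rule ccontr)
    assume "v i \<noteq> r * w i"
    then have "v i - r * w i > 0"
      using ge i by (force simp: v_def)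
    then have "(\<Sum>j\<in>I. A l j * (v j - r * w j)) > 0" if "l \<in> I" for l
      using that i ge by (intro Aw_pos[of l _ i]) (auto simp: v_def)
    moreover have "r * v l = (\<Sum>j\<in>I. A l j * (r * w j))" for l
      by (simp add: v_def sum_distrib_left mult_ac)
    ultimately have strict: "r * v l < (\<Sum>j\<in>I. A l j * v j)" if "l \<in> I" for l
      using that by (simp add: right_diff_distrib sum_subtractf)
    (* The improved vector is A w, rescaled to the simplex; \<mu> is the best factor that works for it. *)
    define \<mu> where "\<mu> = Min ((\<lambda>l. (\<Sum>j\<in>I. A l j * v j) / v l) ` I)"
    have "r < \<mu>"
      unfolding \<mu>_def using fin ne strict v_pos by (subst Min_gr_iff) (auto simp: field_simps)
    have \<mu>: "\<mu> * v l \<le> (\<Sum>j\<in>I. A l j * v j)" if "l \<in> I" for l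
    proof -
      have "\<mu> \<le> (\<Sum>j\<in>I. A l j * v j) / v l"
        unfolding \<mu>_def using fin that by (intro Min_le) auto
      then show ?thesis using v_pos[OF that] by (simp add: field_simps)
    qed
    define s where "s = sum v I"
    have s: "s > 0"
      unfolding s_def using fin ne v_pos by (intro sum_pos) auto
    define x where "x = (\<lambda>l. if l \<in> I then v l / s else 0)"
    have x1: "sum x I = 1"
      using s by (simp add: x_def s_def sum_divide_distrib[symmetric])
    have x0: "x l \<ge> 0" for l
      using v_pos s by (auto simp: x_def less_imp_le)
    have xle: "x l \<le> 1" if "l \<in> I" for l
      using member_le_sum[of l I x] that fin x0 x1 by auto
    have x\<mu>: "\<mu> * x l \<le> (\<Sum>j\<in>I. A l j * x j)" if "l \<in> I" for l
      using \<mu>[OF that] that s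
      by (simp add: x_def sum_divide_distrib[symmetric] divide_right_mono)
    have "\<mu> = (\<Sum>l\<in>I. \<mu> * x l)"
      using x1 by (simp add: sum_distrib_left[symmetric])
    also have "\<dots> \<le> (\<Sum>l\<in>I. \<Sum>j\<in>I. A l j * x j)"
      using x\<mu> by (rule sum_mono)
    also have "\<dots> \<le> L"
      unfolding L_def using xle pos by (intro sum_mono) (simp add: less_imp_le mult_left_le)
    finally have "\<mu> \<le> L" .
    then have "(x, \<mu>) \<in> T"
      using x1 x0 x\<mu> \<open>r < \<mu>\<close> r0 xle
      by (auto simp: T_def K_def) (metis x_def zero_le_one)
    then show False
      using p(2)[of "(x, \<mu>)"] \<open>r < \<mu>\<close> by (simp add: r_def)
  qed
  have "w i > 0" if "i \<in> I" for i
    using v_pos[OF that] eq[OF that] w0[of i] by (metis less_eq_real_def mult_zero_right)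
  then show thesis
    using eq that unfolding v_def by blast
qed

context based_ring
begin

section \<open>Coordinates and additive maps\<close>

abbreviation cf :: "'a \<Rightarrow> 'a \<Rightarrow> int"
  where "cf \<equiv> coord R B"

lemma finite_basis: "finite B"
  and basis_subset: "B \<subseteq> carrier R"
  using basis by (auto simp: is_int_basis_def)

lemma basis_carrier [simp, intro]: "b \<in> B \<Longrightarrow> b \<in> carrier R"
  using basis_subset by auto

declare one_basic [simp]

lemma int_comb_closed: "S \<subseteq> B \<Longrightarrow> int_comb R S a \<in> carrier R"
  unfolding int_comb_def by (intro finsum_closed) auto

lemma coord_extensional: "x \<in> carrier R \<Longrightarrow> cf x \<in> extensional B"
  and int_comb_coord: "x \<in> carrier R \<Longrightarrow> int_comb R B (cf x) = x"
  using basis theI'[of "\<lambda>a. a \<in> extensional B \<and> x = int_comb R B a"]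
  by (auto simp: is_int_basis_def coord_def)

lemma coord_int_comb:
  assumes "b \<in> B"
  shows "cf (int_comb R B a) b = a b"
proof -
  have eq: "int_comb R B (restrict a B) = int_comb R B a"
    unfolding int_comb_def by (intro finsum_cong') auto
  have "\<exists>!a'. a' \<in> extensional B \<and> int_comb R B a = int_comb R B a'"
    using basis int_comb_closed by (auto simp: is_int_basis_def)
  then have "cf (int_comb R B a) = restrict a B"
    unfolding coord_def by (rule the1_equality) (simp add: eq)
  then show ?thesis using assms by simp
qed

lemma coord_add:
  assumes "x \<in> carrier R" "y \<in> carrier R" "b \<in> B"
  shows "cf (x \<oplus> y) b = cf x b + cf y b"
proof -
  have "int_comb R B (\<lambda>b. cf x b + cf y b)
      = (\<Oplus>b\<in>B. add_pow R (cf x b) b \<oplus> add_pow R (cf y b) b)"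
    unfolding int_comb_def by (intro finsum_cong') (auto simp: add.int_pow_mult)
  also have "\<dots> = int_comb R B (cf x) \<oplus> int_comb R B (cf y)"
    unfolding int_comb_def by (intro finsum_addf) auto
  also have "\<dots> = x \<oplus> y"
    using assms by (simp add: int_comb_coord)
  finally show ?thesis
    using coord_int_comb[OF assms(3), of "\<lambda>b. cf x b + cf y b"] by simp
qed

lemma coord_basic:
  assumes "b \<in> B" "k \<in> B"
  shows "cf b k = (if k = b then 1 else 0)"
proof -
  have "int_comb R B (\<lambda>k. if k = b then 1 else 0) = (\<Oplus>k\<in>B. if b = k then k else \<zero>)"
    unfolding int_comb_def by (intro finsum_cong') (auto simp: add_pow_int_ge)
  also have "\<dots> = b"
    using assms finite_basis by (subst add.finprod_singleton) auto
  finally show ?thesis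
    using coord_int_comb[OF assms(2), of "\<lambda>k. if k = b then 1 else 0"] by simp
qed

lemma coord_eqI:
  assumes "x \<in> carrier R" "y \<in> carrier R" "\<And>b. b \<in> B \<Longrightarrow> cf x b = cf y b"
  shows "x = y"
proof -
  have "cf x = cf y"
    using assms coord_extensional by (intro extensionalityI[of _ B]) auto
  then have "int_comb R B (cf x) = int_comb R B (cf y)"
    by simp
  then show ?thesis
    using assms by (simp add: int_comb_coord)
qed

definition additive_map :: "('a \<Rightarrow> 'b::ring_1) \<Rightarrow> bool"
  where "additive_map f \<longleftrightarrow> (\<forall>x\<in>carrier R. \<forall>y\<in>carrier R. f (x \<oplus> y) = f x + f y)"

lemma additive_zero:
  assumes "additive_map f"
  shows "f \<zero> = 0"
proof -
  have "f (\<zero> \<oplus> \<zero>) = f \<zero> + f \<zero>"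
    using assms unfolding additive_map_def by blast
  then show ?thesis by simp
qed

lemma additive_finsum:
  assumes "additive_map f" "finite S" "\<And>s. s \<in> S \<Longrightarrow> g s \<in> carrier R"
  shows "f (\<Oplus>s\<in>S. g s) = (\<Sum>s\<in>S. f (g s))"
  using assms(2,3)
proof (induction rule: finite_induct)
  case empty
  then show ?case using additive_zero[OF assms(1)] by simp
next
  case (insert s S)
  then have "f (g s \<oplus> finsum R g S) = f (g s) + f (finsum R g S)"
    using assms(1) by (auto simp: additive_map_def intro!: finsum_closed)
  then show ?case
    using insert by (subst finsum_insert) auto
qed

lemma additive_add_pow:
  assumes "additive_map f" "x \<in> carrier R"
  shows "f (add_pow R (k::int) x) = of_int k * f x"
proof -
  have nat: "f (add_pow R (n::nat) x) = of_nat n * f x" for n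
  proof (induction n)
    case 0
    then show ?case using additive_zero[OF assms(1)] by simp
  next
    case (Suc n)
    then show ?case
      using assms by (simp add: additive_map_def algebra_simps)
  qed
  have uminus: "f (\<ominus> y) = - f y" if "y \<in> carrier R" for y
  proof -
    have "f y + f (\<ominus> y) = f (y \<oplus> \<ominus> y)"
      using assms that by (simp add: additive_map_def)
    then show ?thesis
      using that additive_zero[OF assms(1)] by (simp add: r_neg eq_neg_iff_add_eq_0 add.commute)
  qed
  show ?thesis
  proof (cases "k \<ge> 0")
    case True
    then show ?thesis using nat[of "nat k"] by (simp add: add_pow_int_ge)
  next
    case False
    then show ?thesis
      using nat[of "nat (- k)"] assms by (simp add: add_pow_int_lt uminus)
  qed
qed

lemma additive_int_comb:
  assumes "additive_map f" "finite S" "S \<subseteq> carrier R"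
  shows "f (int_comb R S a) = (\<Sum>b\<in>S. of_int (a b) * f b)"
  unfolding int_comb_def using assms
  by (subst additive_finsum) (auto intro!: sum.cong simp: additive_add_pow subset_iff)

text \<open>
  The main tool for transferring statements from basic elements to the whole ring: the
  coordinate functionals and \<open>d\<close>, composed with any multiplications, are additive, so each of them
  is determined by its values on the basis.
\<close>

lemma additive_expand:
  assumes "additive_map f" "x \<in> carrier R"
  shows "f x = (\<Sum>b\<in>B. of_int (cf x b) * f b)"
  using additive_int_comb[OF assms(1) finite_basis basis_subset, of "cf x"] assms(2)
  by (simp add: int_comb_coord)

lemma additive_coord: "k \<in> B \<Longrightarrow> additive_map (\<lambda>x. cf x k)"
  by (simp add: additive_map_def coord_add)

lemma additive_combination: "additive_map (\<lambda>x. \<Sum>b\<in>B. of_int (cf x b) * f b)"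
  by (simp add: additive_map_def coord_add distrib_right sum.distrib)

lemma combination_basic:
  assumes "b \<in> B"
  shows "(\<Sum>k\<in>B. of_int (cf b k) * (f k :: 'b::ring_1)) = f b"
proof -
  have "(\<Sum>k\<in>B. of_int (cf b k) * f k) = (\<Sum>k\<in>B. if k = b then f k else 0)"
    using assms by (intro sum.cong) (auto simp: coord_basic)
  then show ?thesis using assms finite_basis by simp
qed

lemma additive_mult_left: "additive_map f \<Longrightarrow> y \<in> carrier R \<Longrightarrow> additive_map (\<lambda>x. f (y \<otimes> x))"
  by (simp add: additive_map_def r_distr)

lemma additive_mult_right: "additive_map f \<Longrightarrow> y \<in> carrier R \<Longrightarrow> additive_map (\<lambda>x. f (x \<otimes> y))"
  by (simp add: additive_map_def l_distr)

section \<open>Frobenius reciprocity\<close>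

lemma invol_closed: "invol R B star x \<in> carrier R"
  unfolding invol_def by (intro finsum_closed) (auto simp: star_basic)

lemma coord_invol:
  assumes "x \<in> carrier R" "k \<in> B"
  shows "cf (invol R B star x) k = cf x (star k)"
proof -
  have "cf (invol R B star x) k = (\<Sum>b\<in>B. cf (add_pow R (cf x b) (star b)) k)"
    unfolding invol_def
    by (rule additive_finsum[OF additive_coord[OF assms(2)] finite_basis]) (simp add: star_basic)
  also have "\<dots> = (\<Sum>b\<in>B. cf x b * cf (star b) k)"
    by (intro sum.cong) (simp_all add: additive_add_pow[OF additive_coord[OF assms(2)]] star_basic)
  also have "\<dots> = (\<Sum>b\<in>B. if b = star k then cf x b else 0)"
    using assms by (intro sum.cong) (auto simp: coord_basic star_basic star_star)
  also have "\<dots> = cf x (star k)"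
    using assms finite_basis by (simp add: star_basic)
  finally show ?thesis .
qed

lemma invol_basic: "b \<in> B \<Longrightarrow> invol R B star b = star b"
  by (intro coord_eqI)
    (auto simp: coord_invol invol_closed star_basic coord_basic star_star)

lemma form_basic:
  assumes "x \<in> carrier R" "b \<in> B"
  shows "basis_form R B x b = cf x b" "basis_form R B b x = cf x b"
  using combination_basic[of b "cf x"] assms(2)
  by (simp_all add: basis_form_def mult.commute)

text \<open>
  This lemma and the next are the two invariance properties of the form, evaluated at basic elements, where
  pairing with \<open>z\<close> reads off the coordinate at \<open>z\<close>.
\<close>

lemma frobenius_right:
  assumes "x \<in> B" "y \<in> B" "z \<in> B"
  shows "cf (x \<otimes> y) z = cf (z \<otimes> star y) x"
  using form_right[of x y z] assms by (simp add: form_basic invol_basic star_basic)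

lemma frobenius_left:
  assumes "x \<in> B" "y \<in> B" "z \<in> B"
  shows "cf (x \<otimes> y) z = cf (star x \<otimes> z) y"
  using form_left[of x y z] assms by (simp add: form_basic invol_basic star_basic)

text \<open>
  Three applications of Frobenius reciprocity move the factors around in turn; the outcome is that
  the involution reverses products.
\<close>

lemma structure_constants_star:
  assumes "x \<in> B" "y \<in> B" "z \<in> B"
  shows "cf (x \<otimes> y) z = cf (star y \<otimes> star x) (star z)"
proof -
  have "cf (x \<otimes> y) z = cf (star x \<otimes> z) y"
    using assms by (rule frobenius_left)
  also have "\<dots> = cf (y \<otimes> star z) (star x)"
    using assms by (intro frobenius_right) (auto simp: star_basic)
  also have "\<dots> = cf (star y \<otimes> star x) (star z)"
    using assms by (intro frobenius_left) (auto simp: star_basic)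
  finally show ?thesis .
qed

lemma one_in_star_product: "b \<in> B \<Longrightarrow> cf (b \<otimes> star b) \<one> = 1"
  using frobenius_right[of \<one> b b] by (simp add: coord_basic)

text \<open>
  If \<open>a b\<close> vanished, so would \<open>a* a b\<close>; but \<open>a* a\<close> contains \<open>1\<close>, hence \<open>a* a b\<close>
  contains \<open>b\<close>, and non-negativity rules out cancellation.
\<close>

lemma product_has_constituent:
  assumes "a \<in> B" "b \<in> B"
  shows "\<exists>k\<in>B. cf (a \<otimes> b) k > 0"
proof (rule ccontr)
  assume "\<not> ?thesis"
  then have "cf (a \<otimes> b) k = 0" if "k \<in> B" for k
    using structure_constants_nonneg[OF assms that] that by force
  then have "a \<otimes> b = \<zero>"
    using assms by (intro coord_eqI) (auto simp: additive_zero[OF additive_coord])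
  then have "star a \<otimes> a \<otimes> b = \<zero>"
    using assms by (simp add: m_assoc star_basic)
  moreover have "cf (star a \<otimes> a \<otimes> b) b \<ge> 1"
  proof -
    have "cf (star a \<otimes> a \<otimes> b) b = (\<Sum>i\<in>B. cf (star a \<otimes> a) i * cf (i \<otimes> b) b)"
      using additive_expand[OF additive_mult_right[OF additive_coord[of b], of b], of "star a \<otimes> a"] assms
      by (simp add: star_basic)
    also have "\<dots> \<ge> cf (star a \<otimes> a) \<one> * cf (\<one> \<otimes> b) b"
      using assms finite_basis
      by (intro member_le_sum) (auto intro!: mult_nonneg_nonneg structure_constants_nonneg star_basic)
    finally show ?thesis
      using one_in_star_product[of "star a"] assms by (simp add: star_basic star_star coord_basic)
  qed
  ultimately show False
    using assms by (simp add: additive_zero[OF additive_coord])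
qed

section \<open>Existence and uniqueness of the Frobenius--Perron dimension\<close>

lemma basis_nonempty: "B \<noteq> {}"
  using one_basic by blast

lemma additive_eqI:
  assumes "additive_map f" "additive_map g" "\<And>b. b \<in> B \<Longrightarrow> f b = g b" "x \<in> carrier R"
  shows "f x = g x"
  using additive_expand[OF assms(1,4)] additive_expand[OF assms(2,4)] assms(3) by simp

text \<open>
  These are the restrictions to the basis of the ring homomorphisms to \<open>\<real>\<close> that are positive there.
  The normalisation at \<open>\<one>\<close> follows, since \<open>f \<one> * f \<one> = f \<one>\<close>.
\<close>

definition positive_character :: "('a \<Rightarrow> real) \<Rightarrow> bool"
  where "positive_character f \<longleftrightarrow> (\<forall>x\<in>B. f x > 0) \<and>
    (\<forall>x\<in>B. \<forall>y\<in>B. f x * f y = (\<Sum>k\<in>B. of_int (cf (x \<otimes> y) k) * f k))"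

text \<open>
  Take a basic \<open>b\<close> at which \<open>f b / g b\<close> has its maximum \<open>M\<close>, and compare the expansions of
  \<open>f x * f b\<close> and \<open>g x * g b\<close> over the constituents of \<open>x b\<close>.
\<close>

lemma positive_character_le:
  assumes f: "positive_character f" and g: "positive_character g" and x: "x \<in> B"
  shows "f x \<le> g x"
proof -
  define M where "M = Max ((\<lambda>b. f b / g b) ` B)"
  have "M \<in> (\<lambda>b. f b / g b) ` B"
    unfolding M_def using finite_basis basis_nonempty by (intro Max_in) auto
  then obtain b where b: "b \<in> B" "M = f b / g b"
    by blast
  have pos: "f b > 0" "g b > 0" "M > 0"
    using f g b by (auto simp: positive_character_def)
  have le: "f k \<le> M * g k" if "k \<in> B" for k
  proof -
    have "f k / g k \<le> M"
      unfolding M_def using finite_basis that by (intro Max_ge) auto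
    then show ?thesis
      using g that by (simp add: positive_character_def field_simps)
  qed
  have "f x * f b = (\<Sum>k\<in>B. of_int (cf (x \<otimes> b) k) * f k)"
    using f x b(1) by (simp add: positive_character_def)
  also have "\<dots> \<le> (\<Sum>k\<in>B. of_int (cf (x \<otimes> b) k) * (M * g k))"
    using x b(1) le structure_constants_nonneg by (intro sum_mono mult_left_mono) auto
  also have "\<dots> = M * (g x * g b)"
  proof -
    have "g x * g b = (\<Sum>k\<in>B. of_int (cf (x \<otimes> b) k) * g k)"
      using g x b(1) by (simp add: positive_character_def)
    then show ?thesis
      by (simp only: sum_distrib_left mult.left_commute)
  qed
  also have "\<dots> = g x * f b"
    using b(2) pos by simp
  finally show ?thesis
    using pos by simp
qed

lemma positive_character_unique:
  assumes "positive_character f" "positive_character g" "x \<in> B"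
  shows "f x = g x"
  using positive_character_le[OF assms] positive_character_le[OF assms(2,1,3)] by simp

text \<open>
  By reciprocity \<open>k\<close> is a constituent of \<open>x j\<close> exactly when \<open>j\<close> is a constituent of \<open>x* k\<close>,
  and that product is nonzero. Perron's argument thus applies to right multiplication by the basis
  sum without any discussion of irreducibility.
\<close>

lemma basis_sum_transitive:
  assumes "x \<in> B" "k \<in> B"
  shows "cf (x \<otimes> int_comb R B (\<lambda>_. 1)) k > 0"
proof -
  have eq: "cf (x \<otimes> int_comb R B (\<lambda>_. 1)) k = (\<Sum>j\<in>B. cf (x \<otimes> j) k)"
    using additive_int_comb[OF additive_mult_left[OF additive_coord[OF assms(2)]] finite_basis basis_subset,
        of x "\<lambda>_. 1"] assms by simp
  obtain j where j: "j \<in> B" "cf (star x \<otimes> k) j > 0"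
    using product_has_constituent[of "star x" k] assms star_basic by blast
  then have "cf (x \<otimes> j) k > 0"
    using frobenius_left[of x j k] assms by simp
  then show ?thesis
    unfolding eq using assms j finite_basis structure_constants_nonneg
    by (intro sum_pos2[of _ j]) auto
qed

text \<open>
  Let \<open>W\<close> be the additive functional given by the Perron eigenvector of right multiplication
  by the basis sum \<open>S\<close>. Left multiplications commute with this operator, so for each basic \<open>y\<close> the
  functional \<open>x \<mapsto> W (y x)\<close> is an eigenfunctional with the same eigenvalue. Strict positivity makes
  it a multiple of \<open>W\<close>, and the factor depends multiplicatively on \<open>y\<close>.
\<close>

lemma positive_character_exists:
  obtains f where "positive_character f"
proof -
  define S where "S = int_comb R B (\<lambda>_. 1)"
  have S: "S \<in> carrier R"
    by (simp add: S_def int_comb_closed)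
  have Spos: "cf (b \<otimes> S) k > 0" if "b \<in> B" "k \<in> B" for b k
    using that by (simp add: S_def basis_sum_transitive)
  define A where "A = (\<lambda>b k. real_of_int (cf (b \<otimes> S) k))"
  have Apos: "A b k > 0" if "b \<in> B" "k \<in> B" for b k
    using Spos that by (simp add: A_def)
  obtain w r where w: "\<And>b. b \<in> B \<Longrightarrow> w b > 0"
    and eigen: "\<And>b. b \<in> B \<Longrightarrow> (\<Sum>k\<in>B. A b k * w k) = r * w b"
    using positive_matrix_eigenvector[of B A, OF finite_basis basis_nonempty Apos] by blast
  define W where "W = (\<lambda>x. \<Sum>b\<in>B. real_of_int (cf x b) * w b)"
  have addW: "additive_map W"
    unfolding W_def by (rule additive_combination)
  have Wb: "W b = w b" if "b \<in> B" for b
    unfolding W_def using that by (rule combination_basic)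
  have WS: "W (x \<otimes> S) = r * W x" if "x \<in> carrier R" for x
  proof (rule additive_eqI[OF _ _ _ that])
    show "additive_map (\<lambda>x. W (x \<otimes> S))"
      using addW S by (rule additive_mult_right)
    show "additive_map (\<lambda>x. r * W x)"
      using addW by (simp add: additive_map_def distrib_left)
    show "W (b \<otimes> S) = r * W b" if "b \<in> B" for b
      using eigen[OF that] Wb[OF that] by (simp add: W_def A_def)
  qed
  have proportional: "W (y \<otimes> x) = W y / W \<one> * W x" if y: "y \<in> B" and x: "x \<in> carrier R" for x y
  proof -
    (* t is the largest factor for which W (y x) - t W x is non-negative on the basis; the zero b0
       of this difference spreads to the whole basis because
       right multiplication by S has only positive entries. *)
    define t where "t = Min ((\<lambda>b. W (y \<otimes> b) / W b) ` B)"
    have "t \<in> (\<lambda>b. W (y \<otimes> b) / W b) ` B"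
      unfolding t_def using finite_basis basis_nonempty by (intro Min_in) auto
    then obtain b0 where b0: "b0 \<in> B" "t = W (y \<otimes> b0) / W b0"
      by blast
    define v where "v = (\<lambda>x. W (y \<otimes> x) - t * W x)"
    have addv: "additive_map v"
      using additive_mult_left[OF addW, of y] addW y
      by (simp add: additive_map_def v_def algebra_simps)
    have v0: "v b0 = 0"
      using b0 w Wb by (force simp: v_def)
    have vpos: "v b \<ge> 0" if "b \<in> B" for b
    proof -
      have "t \<le> W (y \<otimes> b) / W b"
        unfolding t_def using finite_basis that by (intro Min_le) auto
      then show ?thesis
        using w[OF that] Wb[OF that] by (simp add: v_def field_simps)
    qed
    have "v (b0 \<otimes> S) = r * v b0"
      using b0 y S WS[of "y \<otimes> b0"] WS[of b0] by (simp add: v_def algebra_simps m_assoc[symmetric])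
    then have "(\<Sum>k\<in>B. real_of_int (cf (b0 \<otimes> S) k) * v k) = 0"
      using additive_expand[OF addv, of "b0 \<otimes> S"] b0 S v0 by simp
    then have "real_of_int (cf (b0 \<otimes> S) k) * v k = 0" if "k \<in> B" for k
      using that finite_basis vpos Spos[OF b0(1)]
      by (subst (asm) sum_nonneg_eq_0_iff) (auto intro!: mult_nonneg_nonneg simp: less_imp_le)
    then have "v k = 0" if "k \<in> B" for k
      using Spos[OF b0(1) that] that by force
    then have v_zero: "v x = 0" if "x \<in> carrier R" for x
      using additive_expand[OF addv that] by simp
    have "W y = t * W \<one>"
      using v_zero[of \<one>] y by (simp add: v_def)
    moreover have "W \<one> > 0"
      using w Wb by simp
    ultimately show ?thesis
      using v_zero[OF x] by (simp add: v_def)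
  qed
  have "positive_character (\<lambda>b. W b / W \<one>)"
    unfolding positive_character_def
  proof (intro conjI ballI)
    fix x y assume xy: "x \<in> B" "y \<in> B"
    show "W x / W \<one> > 0"
      using w Wb xy by simp
    have "(\<Sum>k\<in>B. of_int (cf (x \<otimes> y) k) * (W k / W \<one>)) = W (x \<otimes> y) / W \<one>"
      using xy by (subst additive_expand[OF addW, of "x \<otimes> y"]) (auto simp: sum_divide_distrib)
    then show "W x / W \<one> * (W y / W \<one>) = (\<Sum>k\<in>B. of_int (cf (x \<otimes> y) k) * (W k / W \<one>))"
      using proportional[of x y] xy by simp
  qed
  then show thesis by (rule that)
qed

lemma real_ring_hom_iff:
  "f \<in> ring_hom R (ring_of_type_algebra :: real ring) \<longleftrightarrow>
    additive_map f \<and> (\<forall>x\<in>carrier R. \<forall>y\<in>carrier R. f (x \<otimes> y) = f x * f y) \<and> f \<one> = 1"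
  by (auto simp: ring_hom_def ring_of_type_algebra_def additive_map_def)

lemma positive_character_extends_to_hom:
  assumes "positive_character f"
  shows "(\<lambda>x\<in>carrier R. \<Sum>b\<in>B. real_of_int (cf x b) * f b)
    \<in> ring_hom R (ring_of_type_algebra :: real ring)"
proof -
  define F where "F = (\<lambda>x. \<Sum>b\<in>B. real_of_int (cf x b) * f b)"
  have addF: "additive_map F"
    unfolding F_def by (rule additive_combination)
  have Fb: "F b = f b" if "b \<in> B" for b
    unfolding F_def using that by (rule combination_basic)
  have basic: "F (b \<otimes> k) = F b * F k" if "b \<in> B" "k \<in> B" for b k
  proof -
    have "F (b \<otimes> k) = f b * f k"
      using assms that by (simp add: positive_character_def F_def)
    then show ?thesis
      using that by (simp add: Fb)
  qed
  have left: "F (b \<otimes> y) = F b * F y" if "b \<in> B" "y \<in> carrier R" for b y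
  proof (rule additive_eqI[OF _ _ _ that(2)])
    show "additive_map (\<lambda>y. F (b \<otimes> y))"
      using addF basis_carrier[OF that(1)] by (rule additive_mult_left)
    show "additive_map (\<lambda>y. F b * F y)"
      using addF by (simp add: additive_map_def distrib_left)
  qed (use basic that in auto)
  have mult: "F (x \<otimes> y) = F x * F y" if "x \<in> carrier R" "y \<in> carrier R" for x y
  proof (rule additive_eqI[OF _ _ _ that(1)])
    show "additive_map (\<lambda>x. F (x \<otimes> y))"
      using addF that(2) by (rule additive_mult_right)
    show "additive_map (\<lambda>x. F x * F y)"
      using addF by (simp add: additive_map_def distrib_right)
  qed (use left that in auto)
  have "F \<one> > 0"
    using assms Fb[OF one_basic] by (simp add: positive_character_def)
  moreover have "F \<one> * F \<one> = F \<one>"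
    using mult[of \<one> \<one>] by simp
  ultimately have "F \<one> = 1"
    by simp
  then show ?thesis
    using addF mult unfolding real_ring_hom_iff F_def[symmetric] additive_map_def by simp
qed

lemma positive_hom_character:
  assumes "f \<in> ring_hom R (ring_of_type_algebra :: real ring)" "\<And>b. b \<in> B \<Longrightarrow> f b > 0"
  shows "positive_character f"
  unfolding positive_character_def
proof (intro conjI ballI)
  fix x y assume xy: "x \<in> B" "y \<in> B"
  show "f x > 0"
    using assms(2) xy by simp
  have "f (x \<otimes> y) = (\<Sum>k\<in>B. of_int (cf (x \<otimes> y) k) * f k)"
    using assms(1) xy by (intro additive_expand) (auto simp: real_ring_hom_iff)
  then show "f x * f y = (\<Sum>k\<in>B. of_int (cf (x \<otimes> y) k) * f k)"
    using assms(1) xy by (simp add: real_ring_hom_iff)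
qed

text \<open>
  This turns the definite description into usable facts: the homomorphism it speaks of exists and is
  unique.
\<close>

lemma FPdim_properties:
  "FPdim R B \<in> extensional (carrier R) \<and>
    FPdim R B \<in> ring_hom R (ring_of_type_algebra :: real ring) \<and> (\<forall>b\<in>B. FPdim R B b > 0)"
proof -
  obtain f where f: "positive_character f"
    by (rule positive_character_exists)
  have "\<exists>!f. f \<in> extensional (carrier R) \<and>
    f \<in> ring_hom R (ring_of_type_algebra :: real ring) \<and> (\<forall>b\<in>B. f b > 0)"
  proof (rule ex_ex1I)
    show "\<exists>f. f \<in> extensional (carrier R) \<and>
      f \<in> ring_hom R (ring_of_type_algebra :: real ring) \<and> (\<forall>b\<in>B. f b > 0)"
      using positive_character_extends_to_hom[OF f] f combination_basic[of _ f]
      by (intro exI[of _ "\<lambda>x\<in>carrier R. \<Sum>b\<in>B. real_of_int (cf x b) * f b"])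
        (auto simp: positive_character_def)
  next
    fix f g
    assume "f \<in> extensional (carrier R) \<and>
        f \<in> ring_hom R (ring_of_type_algebra :: real ring) \<and> (\<forall>b\<in>B. f b > 0)"
      and "g \<in> extensional (carrier R) \<and>
        g \<in> ring_hom R (ring_of_type_algebra :: real ring) \<and> (\<forall>b\<in>B. g b > 0)"
    then have fg: "f \<in> extensional (carrier R)" "g \<in> extensional (carrier R)"
      "positive_character f" "positive_character g" "additive_map f" "additive_map g"
      by (auto intro: positive_hom_character simp: real_ring_hom_iff)
    show "f = g"
      using fg(1,2) additive_eqI[OF fg(5,6) positive_character_unique[OF fg(3,4)]]
      by (rule extensionalityI)
  qed
  from theI'[OF this] show ?thesis
    unfolding FPdim_def .
qed

abbreviation d :: "'a \<Rightarrow> real"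
  where "d \<equiv> FPdim R B"

lemma FPdim_additive: "additive_map d"
  and FPdim_mult: "x \<in> carrier R \<Longrightarrow> y \<in> carrier R \<Longrightarrow> d (x \<otimes> y) = d x * d y"
  and FPdim_one: "d \<one> = 1"
  and FPdim_pos: "b \<in> B \<Longrightarrow> d b > 0"
  using FPdim_properties by (auto simp: real_ring_hom_iff)

lemma FPdim_character: "positive_character d"
  by (rule positive_hom_character) (use FPdim_properties in auto)

text \<open>
  As the involution reverses products, \<open>b \<mapsto> d (b*)\<close> is also a positive character, and there is
  only one.
\<close>

lemma FPdim_star:
  assumes "b \<in> B"
  shows "d (star b) = d b"
proof (rule positive_character_unique[OF _ FPdim_character assms])
  have bij: "bij_betw star B B"
    by (rule bij_betwI[where g = star]) (auto simp: star_basic star_star)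
  show "positive_character (\<lambda>b. d (star b))"
    unfolding positive_character_def
  proof (intro conjI ballI)
    fix x y assume xy: "x \<in> B" "y \<in> B"
    show "d (star x) > 0"
      using xy by (simp add: FPdim_pos star_basic)
    have "d (star x) * d (star y) = d (star y \<otimes> star x)"
      using xy by (simp add: FPdim_mult star_basic)
    also have "\<dots> = (\<Sum>k\<in>B. of_int (cf (star y \<otimes> star x) k) * d k)"
      using xy by (intro additive_expand[OF FPdim_additive]) (simp add: star_basic)
    also have "\<dots> = (\<Sum>k\<in>B. of_int (cf (star y \<otimes> star x) (star k)) * d (star k))"
      by (rule sum.reindex_bij_betw[OF bij, symmetric])
    also have "\<dots> = (\<Sum>k\<in>B. of_int (cf (x \<otimes> y) k) * d (star k))"
      using xy by (intro sum.cong) (simp_all add: structure_constants_star[of x y])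
    finally show "d (star x) * d (star y) = (\<Sum>k\<in>B. of_int (cf (x \<otimes> y) k) * d (star k))" .
  qed
qed

section \<open>Gradings from degree functions on the basis\<close>

lemma coord_int_comb_subset:
  assumes "S \<subseteq> B" "b \<in> B"
  shows "cf (int_comb R S a) b = (if b \<in> S then a b else 0)"
proof -
  have fin: "finite S"
    using assms(1) finite_basis finite_subset by blast
  have "cf (int_comb R S a) b = (\<Sum>s\<in>S. a s * cf s b)"
    using additive_int_comb[OF additive_coord[OF assms(2)] fin, of a] assms basis_subset by auto
  also have "\<dots> = (\<Sum>s\<in>S. if s = b then a b else 0)"
    using assms by (intro sum.cong) (auto simp: coord_basic)
  also have "\<dots> = (if b \<in> S then a b else 0)"
    using fin by simp
  finally show ?thesis .
qed

lemma int_span_iff: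
  assumes "S \<subseteq> B"
  shows "x \<in> int_span R S \<longleftrightarrow> x \<in> carrier R \<and> (\<forall>b\<in>B - S. cf x b = 0)"
proof
  assume "x \<in> int_span R S"
  then show "x \<in> carrier R \<and> (\<forall>b\<in>B - S. cf x b = 0)"
    using assms by (auto simp: int_span_def int_comb_closed coord_int_comb_subset)
next
  assume x: "x \<in> carrier R \<and> (\<forall>b\<in>B - S. cf x b = 0)"
  then have "x = int_comb R S (cf x)"
    using assms by (intro coord_eqI) (auto simp: int_comb_closed coord_int_comb_subset)
  then show "x \<in> int_span R S"
    unfolding int_span_def by blast
qed

lemma basic_nonzero: "b \<in> B \<Longrightarrow> b \<noteq> \<zero>"
  using coord_basic[of b b] additive_zero[OF additive_coord, of b] by auto

lemma invol_invol: "x \<in> carrier R \<Longrightarrow> invol R B star (invol R B star x) = x"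
  by (intro coord_eqI) (auto simp: coord_invol invol_closed star_basic star_star)

text \<open>
  Since the homogeneous components are spans of parts of the basis, every clause of the definition of
  a grading can be tested on coordinates.
\<close>

lemma grading_by_degree:
  fixes G :: "('g, 'n) monoid_scheme" and deg :: "'a \<Rightarrow> 'g"
  assumes G: "group G" "finite (carrier G)"
    and deg: "\<And>b. b \<in> B \<Longrightarrow> deg b \<in> carrier G"
    and deg_mult: "\<And>a b k. \<lbrakk>a \<in> B; b \<in> B; k \<in> B; cf (a \<otimes> b) k \<noteq> 0\<rbrakk>
      \<Longrightarrow> deg k = deg a \<otimes>\<^bsub>G\<^esub> deg b"
    and deg_star: "\<And>b. b \<in> B \<Longrightarrow> deg (star b) = inv\<^bsub>G\<^esub> deg b"
  shows "is_grading R B star G (\<lambda>g. {b \<in> B. deg b = g})"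
proof -
  define C where "C = (\<lambda>g. {b \<in> B. deg b = g})"
  interpret G: group G by (rule G)
  have C: "C g \<subseteq> B" for g
    by (auto simp: C_def)
  have span: "x \<in> int_span R (C g) \<longleftrightarrow> x \<in> carrier R \<and> (\<forall>b\<in>B. deg b \<noteq> g \<longrightarrow> cf x b = 0)" for x g
    unfolding int_span_iff[OF C] by (auto simp: C_def)
  have coord_sum: "cf (\<Oplus>g\<in>carrier G. u g) b = cf (u (deg b)) b"
    if u: "\<And>g. g \<in> carrier G \<Longrightarrow> u g \<in> int_span R (C g)" and b: "b \<in> B" for u b
  proof -
    have "cf (\<Oplus>g\<in>carrier G. u g) b = (\<Sum>g\<in>carrier G. cf (u g) b)"
      using u by (intro additive_finsum[OF additive_coord[OF b] G(2)]) (simp add: span)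
    also have "\<dots> = (\<Sum>g\<in>carrier G. if g = deg b then cf (u (deg b)) b else 0)"
      using u b by (intro sum.cong) (auto simp: span)
    finally show ?thesis
      using deg[OF b] G(2) by simp
  qed
  have decomposition: "\<exists>!u. u \<in> (\<Pi>\<^sub>E g\<in>carrier G. int_span R (C g)) \<and> x = (\<Oplus>g\<in>carrier G. u g)"
    if x: "x \<in> carrier R" for x
  proof (rule ex_ex1I)
    define u where "u = (\<lambda>g\<in>carrier G. int_comb R (C g) (cf x))"
    have u: "u g \<in> int_span R (C g)" if "g \<in> carrier G" for g
      using that by (simp add: u_def int_span_def)
    have "x = (\<Oplus>g\<in>carrier G. u g)"
    proof (rule coord_eqI[OF x])
      show "(\<Oplus>g\<in>carrier G. u g) \<in> carrier R"
        using u by (intro finsum_closed) (auto simp: span)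
      show "cf x b = cf (\<Oplus>g\<in>carrier G. u g) b" if "b \<in> B" for b
        using coord_sum[OF u that] deg[OF that] that
        by (simp add: u_def coord_int_comb_subset[OF C that]) (simp add: C_def)
    qed
    then show "\<exists>u. u \<in> (\<Pi>\<^sub>E g\<in>carrier G. int_span R (C g)) \<and> x = (\<Oplus>g\<in>carrier G. u g)"
      using u by (intro exI[of _ u]) (auto simp: u_def)
  next
    fix u v
    assume "u \<in> (\<Pi>\<^sub>E g\<in>carrier G. int_span R (C g)) \<and> x = (\<Oplus>g\<in>carrier G. u g)"
      and "v \<in> (\<Pi>\<^sub>E g\<in>carrier G. int_span R (C g)) \<and> x = (\<Oplus>g\<in>carrier G. v g)"
    then have u: "u \<in> extensional (carrier G)" "\<And>g. g \<in> carrier G \<Longrightarrow> u g \<in> int_span R (C g)"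
        "x = (\<Oplus>g\<in>carrier G. u g)"
      and v: "v \<in> extensional (carrier G)" "\<And>g. g \<in> carrier G \<Longrightarrow> v g \<in> int_span R (C g)"
        "x = (\<Oplus>g\<in>carrier G. v g)"
      by (auto simp: PiE_iff)
    show "u = v"
    proof (rule extensionalityI[OF u(1) v(1)])
      fix g assume g: "g \<in> carrier G"
      show "u g = v g"
      proof (rule coord_eqI)
        fix b assume b: "b \<in> B"
        show "cf (u g) b = cf (v g) b"
        proof (cases "deg b = g")
          case True
          then show ?thesis
            using coord_sum[OF u(2) b] coord_sum[OF v(2) b] u(3) v(3) by simp
        next
          case False
          then show ?thesis
            using u(2)[OF g] v(2)[OF g] b by (simp add: span)
        qed
      qed (use u(2)[OF g] v(2)[OF g] in \<open>simp_all add: span\<close>)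
    qed
  qed
  have product: "x \<otimes> y \<in> int_span R (C (g \<otimes>\<^bsub>G\<^esub> h))"
    if x: "x \<in> int_span R (C g)" and y: "y \<in> int_span R (C h)" for x y g h
  proof -
    have xy: "x \<in> carrier R" "y \<in> carrier R"
      using x y by (simp_all add: span)
    have "cf (x \<otimes> y) k = 0" if k: "k \<in> B" "deg k \<noteq> g \<otimes>\<^bsub>G\<^esub> h" for k
    proof -
      have inner: "cf x a * cf (a \<otimes> y) k = 0" if a: "a \<in> B" for a
      proof (cases "deg a = g")
        case True
        have "cf (a \<otimes> y) k = (\<Sum>b\<in>B. cf y b * cf (a \<otimes> b) k)"
          using additive_expand[OF additive_mult_left[OF additive_coord[OF k(1)]], of a y] a xy by simp
        moreover have "cf y b * cf (a \<otimes> b) k = 0" if "b \<in> B" for b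
          using that a k y True deg_mult[of a b k] by (auto simp: span)
        ultimately show ?thesis by simp
      next
        case False
        then show ?thesis using x a by (simp add: span)
      qed
      have "cf (x \<otimes> y) k = (\<Sum>a\<in>B. cf x a * cf (a \<otimes> y) k)"
        using additive_expand[OF additive_mult_right[OF additive_coord[OF k(1)]], of y x] xy by simp
      then show ?thesis
        using inner by simp
    qed
    then show ?thesis
      using xy by (simp add: span)
  qed
  have invol_mem: "invol R B star x \<in> int_span R (C (inv\<^bsub>G\<^esub> g))"
    if g: "g \<in> carrier G" and x: "x \<in> int_span R (C g)" for g x
  proof -
    have "cf x (star b) = 0" if "b \<in> B" "deg b \<noteq> inv\<^bsub>G\<^esub> g" for b
    proof -
      have "deg (star b) \<noteq> g"
        using deg_star[OF that(1)] deg[OF that(1)] that(2) by auto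
      then show ?thesis
        using x that(1) by (simp add: span star_basic)
    qed
    then show ?thesis
      using x by (simp add: span invol_closed coord_invol)
  qed
  have involution: "invol R B star ` int_span R (C g) = int_span R (C (inv\<^bsub>G\<^esub> g))"
    if g: "g \<in> carrier G" for g
  proof (intro subset_antisym subsetI)
    fix y assume "y \<in> int_span R (C (inv\<^bsub>G\<^esub> g))"
    then have "invol R B star y \<in> int_span R (C g)" "y = invol R B star (invol R B star y)"
      using g invol_mem[of "inv\<^bsub>G\<^esub> g" y] by (simp_all add: invol_invol span)
    then show "y \<in> invol R B star ` int_span R (C g)"
      by blast
  qed (use g invol_mem in auto)
  have union: "(\<Union>g\<in>carrier G. C g) = B"
    using deg by (auto simp: C_def)
  have disjoint: "disjoint_family_on C (carrier G)"
    by (auto simp: C_def disjoint_family_on_def)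
  have "is_grading R B star G C"
    unfolding is_grading_def
    by (intro conjI ballI G union disjoint decomposition product involution)
  then show ?thesis
    by (simp add: C_def)
qed

end

section \<open>Rationality of dimensions on connected components\<close>

locale integral_based_ring = based_ring +
  assumes FPdim_integral: "FPdim_ring R B \<in> \<int>"
begin

text \<open>
  The components of this relation are the classes of basic elements between which dimensions will be
  compared; \<open>1\<close> is in the component that contains the constituents of all \<open>b b*\<close>.
\<close>

definition linked :: "'a \<Rightarrow> 'a \<Rightarrow> bool"
  where "linked x y \<longleftrightarrow> x \<in> B \<and> y \<in> B \<and> (\<exists>b\<in>B. \<exists>k\<in>B. cf (x \<otimes> b) k > 0 \<and> cf (y \<otimes> b) k > 0)"

lemma linked_sym: "linked x y \<Longrightarrow> linked y x"
  unfolding linked_def by blast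

text \<open>
  By reciprocity \<open>b\<close> is a constituent of both \<open>k c*\<close> and \<open>l c*\<close>.
\<close>

lemma constituents_linked:
  assumes "b \<in> B" "c \<in> B" "k \<in> B" "l \<in> B" "cf (b \<otimes> c) k > 0" "cf (b \<otimes> c) l > 0"
  shows "linked k l"
  using assms frobenius_right[of b c k] frobenius_right[of b c l] star_basic
  unfolding linked_def by auto

text \<open>
  The right-hand side is symmetric in \<open>x\<close> and \<open>y\<close>, so right multiplication by \<open>b b*\<close> is a
  symmetric matrix, and its entry is positive exactly when \<open>x b\<close> and \<open>y b\<close> share a constituent.
\<close>

lemma coord_mult_adjoint:
  assumes "x \<in> B" "y \<in> B" "b \<in> B"
  shows "cf (x \<otimes> (b \<otimes> star b)) y = (\<Sum>k\<in>B. cf (x \<otimes> b) k * cf (y \<otimes> b) k)"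
proof -
  have "cf (x \<otimes> (b \<otimes> star b)) y = cf ((x \<otimes> b) \<otimes> star b) y"
    using assms by (simp add: m_assoc star_basic)
  also have "\<dots> = (\<Sum>k\<in>B. cf (x \<otimes> b) k * cf (k \<otimes> star b) y)"
    using additive_expand[OF additive_mult_right[OF additive_coord], of y "star b" "x \<otimes> b"] assms
    by (simp add: star_basic)
  also have "\<dots> = (\<Sum>k\<in>B. cf (x \<otimes> b) k * cf (y \<otimes> b) k)"
    using assms by (intro sum.cong) (simp_all add: frobenius_right[of _ "star b" y] star_basic star_star)
  finally show ?thesis .
qed

lemma linked_if_coord_adjoint:
  assumes "x \<in> B" "y \<in> B" "b \<in> B" "cf (x \<otimes> (b \<otimes> star b)) y \<noteq> 0"
  shows "linked x y"
proof -
  have "(\<Sum>k\<in>B. cf (x \<otimes> b) k * cf (y \<otimes> b) k) \<noteq> 0"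
    using assms(4) unfolding coord_mult_adjoint[OF assms(1-3)] .
  then obtain k where k: "k \<in> B" "cf (x \<otimes> b) k * cf (y \<otimes> b) k \<noteq> 0"
    by (rule sum.not_neutral_contains_not_neutral)
  then have "cf (x \<otimes> b) k > 0" "cf (y \<otimes> b) k > 0"
    using assms structure_constants_nonneg[of x b k] structure_constants_nonneg[of y b k] by auto
  then show ?thesis
    using assms k unfolding linked_def by blast
qed

definition casimir :: 'a
  where "casimir = (\<Oplus>b\<in>B. b \<otimes> star b)"

lemma casimir_closed [simp]: "casimir \<in> carrier R"
  unfolding casimir_def by (intro finsum_closed) (auto simp: star_basic)

lemma coord_mult_casimir:
  assumes "x \<in> B" "y \<in> B"
  shows "cf (x \<otimes> casimir) y = (\<Sum>b\<in>B. cf (x \<otimes> (b \<otimes> star b)) y)"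
  unfolding casimir_def
  by (rule additive_finsum[OF additive_mult_left[OF additive_coord] finite_basis])
    (use assms in \<open>auto simp: star_basic\<close>)

lemma coord_adjoint_nonneg:
  assumes "x \<in> B" "y \<in> B" "b \<in> B"
  shows "cf (x \<otimes> (b \<otimes> star b)) y \<ge> 0"
  unfolding coord_mult_adjoint[OF assms] using assms
  by (intro sum_nonneg mult_nonneg_nonneg structure_constants_nonneg)

lemma coord_casimir_nonneg:
  assumes "x \<in> B" "y \<in> B"
  shows "cf (x \<otimes> casimir) y \<ge> 0"
  unfolding coord_mult_casimir[OF assms] using assms
  by (intro sum_nonneg coord_adjoint_nonneg)

lemma coord_casimir_pos_iff:
  assumes "x \<in> B" "y \<in> B"
  shows "cf (x \<otimes> casimir) y > 0 \<longleftrightarrow> linked x y"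
proof
  assume "cf (x \<otimes> casimir) y > 0"
  then have "(\<Sum>b\<in>B. cf (x \<otimes> (b \<otimes> star b)) y) \<noteq> 0"
    unfolding coord_mult_casimir[OF assms] by simp
  then obtain b where "b \<in> B" "cf (x \<otimes> (b \<otimes> star b)) y \<noteq> 0"
    by (rule sum.not_neutral_contains_not_neutral)
  then show "linked x y"
    using assms linked_if_coord_adjoint by blast
next
  assume "linked x y"
  then obtain b k where bk: "b \<in> B" "k \<in> B" "cf (x \<otimes> b) k > 0" "cf (y \<otimes> b) k > 0"
    unfolding linked_def by blast
  have "cf (x \<otimes> (b \<otimes> star b)) y > 0"
    unfolding coord_mult_adjoint[OF assms bk(1)] using bk assms finite_basis
    by (intro sum_pos2[of _ k]) (auto intro!: mult_nonneg_nonneg structure_constants_nonneg)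
  then show "cf (x \<otimes> casimir) y > 0"
    unfolding coord_mult_casimir[OF assms] using bk(1) assms finite_basis
    by (intro sum_pos2[of _ b]) (auto intro!: coord_adjoint_nonneg)
qed

lemma FPdim_casimir: "d casimir = FPdim_ring R B"
proof -
  have "d casimir = (\<Sum>b\<in>B. d (b \<otimes> star b))"
    unfolding casimir_def
    by (rule additive_finsum[OF FPdim_additive finite_basis]) (simp add: star_basic)
  also have "\<dots> = (\<Sum>b\<in>B. (d b)\<^sup>2)"
    by (intro sum.cong) (simp_all add: FPdim_mult FPdim_star star_basic power2_eq_square)
  finally show ?thesis
    by (simp add: FPdim_ring_def)
qed

abbreviation connected_basic :: "'a \<Rightarrow> 'a \<Rightarrow> bool"
  where "connected_basic \<equiv> linked\<^sup>*\<^sup>*"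

lemma connected_basic_mem: "connected_basic x y \<Longrightarrow> x \<in> B \<Longrightarrow> y \<in> B"
  by (induction rule: rtranclp_induct) (auto simp: linked_def)

lemma connected_basic_sym: "connected_basic x y \<Longrightarrow> connected_basic y x"
  by (induction rule: rtranclp_induct) (auto intro: linked_sym converse_rtranclp_into_rtranclp)

text \<open>
  The functional \<open>h z = \<phi> (d z / d x)\<close> satisfies the same eigenvalue equation as \<open>d\<close>, since
  \<open>\<phi>\<close> commutes with integer multiples. Subtract from \<open>h\<close> the largest multiple \<open>t d\<close> for which the
  difference \<open>v\<close> is non-negative on the component of \<open>x\<close>. The eigenvalue equation propagates the zero
  of \<open>v\<close> along links, so \<open>h\<close> and \<open>t d\<close> agree on the component, and \<open>h x = 1\<close> determines \<open>t\<close>.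
\<close>

lemma FPdim_ratio_rational:
  assumes x: "x \<in> B" and xy: "connected_basic x y"
  shows "d y / d x \<in> \<rat>"
proof -
  obtain m where m: "FPdim_ring R B = of_int m"
    using FPdim_integral by (auto elim: Ints_cases)
  obtain \<phi> :: "real \<Rightarrow> real"
    where \<phi>_add: "\<And>r s. \<phi> (r + s) = \<phi> r + \<phi> s" and \<phi>_one: "\<phi> 1 = 1" and \<phi>_rat: "\<And>r. \<phi> r \<in> \<rat>"
    by (rule additive_rational_retraction) blast
  define T where "T = {z \<in> B. connected_basic x z}"
  define h where "h = (\<lambda>z. \<phi> (d z / d x))"
  have h_casimir: "h (z \<otimes> casimir) = of_int m * h z" if "z \<in> carrier R" for z
  proof -
    have "d (z \<otimes> casimir) / d x = of_int m * (d z / d x)"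
      using that by (simp add: FPdim_mult FPdim_casimir m)
    then show ?thesis
      unfolding h_def using additive_int_multiple[of \<phi> m "d z / d x", OF \<phi>_add] by (simp only:)
  qed
  define t where "t = Min ((\<lambda>z. h z / d z) ` T)"
  have T: "finite T" "x \<in> T" "y \<in> T"
    using finite_basis x xy connected_basic_mem by (auto simp: T_def)
  then have "t \<in> (\<lambda>z. h z / d z) ` T"
    unfolding t_def by (intro Min_in) auto
  then obtain z0 where z0: "z0 \<in> T" "t = h z0 / d z0"
    by blast
  define v where "v = (\<lambda>z. h z - t * d z)"
  have add_v: "additive_map v"
    using FPdim_additive \<phi>_add
    by (simp add: additive_map_def v_def h_def add_divide_distrib distrib_left)
  have v_nonneg: "v z \<ge> 0" if "z \<in> T" for z
  proof -
    have "t \<le> h z / d z"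
      unfolding t_def using T(1) that by (intro Min_le) auto
    moreover have "d z > 0"
      using that by (simp add: T_def FPdim_pos)
    ultimately show ?thesis
      by (simp add: v_def field_simps)
  qed
  have v_z0: "v z0 = 0"
    using z0 FPdim_pos[of z0] by (simp add: v_def T_def)
  have propagate: "k \<in> T \<and> v k = 0" if z: "z \<in> T" "v z = 0" and link: "linked z k" for z k
  proof -
    have zB: "z \<in> B" and kB: "k \<in> B"
      using z(1) link by (auto simp: T_def linked_def)
    have in_T: "j \<in> T" if "linked z j" for j
    proof -
      have "j \<in> B"
        using that by (simp add: linked_def)
      then show ?thesis
        using z(1) that by (auto simp: T_def)
    qed
    have nonneg: "of_int (cf (z \<otimes> casimir) j) * v j \<ge> 0" if "j \<in> B" for j
      using that zB coord_casimir_nonneg[of z j] coord_casimir_pos_iff[of z j] in_T v_nonneg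
      by (cases "cf (z \<otimes> casimir) j = 0") auto
    have "(\<Sum>j\<in>B. of_int (cf (z \<otimes> casimir) j) * v j) = v (z \<otimes> casimir)"
      using zB by (intro additive_expand[OF add_v, symmetric]) simp
    also have "\<dots> = of_int m * v z"
      using zB by (simp add: v_def h_casimir FPdim_mult FPdim_casimir m algebra_simps)
    finally have "(\<Sum>j\<in>B. of_int (cf (z \<otimes> casimir) j) * v j) = 0"
      using z(2) by simp
    then have "of_int (cf (z \<otimes> casimir) k) * v k = 0"
      using kB finite_basis nonneg by (subst (asm) sum_nonneg_eq_0_iff) auto
    then show ?thesis
      using link coord_casimir_pos_iff[OF zB kB] in_T by simp
  qed
  have v_zero: "v z = 0" if "z \<in> T" for z
  proof -
    have "connected_basic z0 z"
      using that z0(1) connected_basic_sym[of x z0] by (auto simp: T_def)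
    then have "z \<in> T \<and> v z = 0"
    proof (induction rule: rtranclp_induct)
      case base
      show ?case using z0(1) v_z0 by simp
    next
      case (step k l)
      then show ?case using propagate by blast
    qed
    then show ?thesis by simp
  qed
  (* Here the normalisation \<phi> 1 = 1 enters. *)
  have "t * d x = 1"
    using v_zero[OF T(2)] FPdim_pos[OF x] \<phi>_one by (simp add: v_def h_def)
  then have "t = 1 / d x"
    using FPdim_pos[OF x] by (simp add: field_simps)
  then have "\<phi> (d y / d x) = d y / d x"
    using v_zero[OF T(3)] by (simp add: v_def h_def)
  then show ?thesis
    using \<phi>_rat[of "d y / d x"] by simp
qed

text \<open>
  The dimensions \<open>d k\<close> in the component of \<open>1\<close> are rational, say with common denominator \<open>N\<close>.
  Because \<open>(d b)\<^sup>2 * d k = d (k b b*)\<close> is an integer combination of dimensions of the same component,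
  \<open>N\<close> is also a denominator for all \<open>((d b)\<^sup>2) ^ n * d k\<close>.
\<close>

lemma FPdim_square_integral:
  assumes b: "b \<in> B"
  shows "(d b)\<^sup>2 \<in> \<int>"
proof -
  define T where "T = {k \<in> B. connected_basic \<one> k}"
  have rat: "d k \<in> \<rat>" if "k \<in> T" for k
    using FPdim_ratio_rational[OF one_basic, of k] that by (simp add: T_def FPdim_one)
  have "finite T"
    using finite_basis by (simp add: T_def)
  then obtain N where N: "N > 0" "\<And>k. k \<in> T \<Longrightarrow> real N * d k \<in> \<int>"
    using finite_common_denominator[of T d] rat by blast
  have powers: "real N * ((d b)\<^sup>2) ^ n * d k \<in> \<int>" if "k \<in> T" for n k
    using that
  proof (induction n arbitrary: k)
    case 0
    then show ?case using N by simp
  next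
    case (Suc n)
    have kB: "k \<in> B"
      using Suc.prems by (simp add: T_def)
    have "(d b)\<^sup>2 * d k = d (k \<otimes> (b \<otimes> star b))"
      using b kB by (simp add: FPdim_mult FPdim_star star_basic power2_eq_square)
    also have "\<dots> = (\<Sum>j\<in>B. of_int (cf (k \<otimes> (b \<otimes> star b)) j) * d j)"
      using b kB by (intro additive_expand[OF FPdim_additive]) (simp add: star_basic)
    finally have "real N * ((d b)\<^sup>2) ^ Suc n * d k
        = real N * ((d b)\<^sup>2) ^ n * (\<Sum>j\<in>B. of_int (cf (k \<otimes> (b \<otimes> star b)) j) * d j)"
      by simp
    also have "\<dots> = (\<Sum>j\<in>B. of_int (cf (k \<otimes> (b \<otimes> star b)) j) * (real N * ((d b)\<^sup>2) ^ n * d j))"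
      by (simp only: sum_distrib_left mult.left_commute)
    also have "\<dots> \<in> \<int>"
    proof (rule Ints_sum)
      fix j assume j: "j \<in> B"
      show "of_int (cf (k \<otimes> (b \<otimes> star b)) j) * (real N * ((d b)\<^sup>2) ^ n * d j) \<in> \<int>"
      proof (cases "cf (k \<otimes> (b \<otimes> star b)) j = 0")
        case False
        then have "linked k j"
          using linked_if_coord_adjoint[OF kB j b] by simp
        then have "j \<in> T"
          using Suc.prems j by (auto simp: T_def)
        then show ?thesis
          by (intro Ints_mult Suc.IH) auto
      qed simp
    qed
    finally show ?case .
  qed
  have one: "\<one> \<in> T"
    by (simp add: T_def)
  have powers_one: "real N * ((d b)\<^sup>2) ^ n \<in> \<int>" for n
    using powers[OF one, of n] by (simp add: FPdim_one)
  have "(d b)\<^sup>2 = real N * ((d b)\<^sup>2) ^ 1 / real N"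
    using N(1) by simp
  also have "\<dots> \<in> \<rat>"
    using powers_one[of 1] Ints_subset_Rats by (intro Rats_divide) auto
  finally show ?thesis
    using N(1) powers_one by (rule rational_bounded_denominator_powers)
qed

section \<open>The grading by radicands\<close>

definition FPdim_square :: "'a \<Rightarrow> nat"
  where "FPdim_square b = nat \<lfloor>(d b)\<^sup>2\<rfloor>"

lemma real_FPdim_square: "b \<in> B \<Longrightarrow> real (FPdim_square b) = (d b)\<^sup>2"
  using FPdim_square_integral[of b] by (auto simp: FPdim_square_def elim!: Ints_cases)

lemma FPdim_square_pos: "b \<in> B \<Longrightarrow> FPdim_square b > 0"
proof -
  assume "b \<in> B"
  then have "real (FPdim_square b) > 0"
    using FPdim_pos[of b] by (simp add: real_FPdim_square)
  then show ?thesis by simp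
qed

definition radicand :: "'a \<Rightarrow> nat"
  where "radicand b = squarefree_part (FPdim_square b)"

lemma FPdim_basic_eq:
  assumes "b \<in> B"
  shows "d b = real (square_part (FPdim_square b)) * sqrt (real (radicand b))"
proof -
  have "(d b)\<^sup>2 = real (FPdim_square b)"
    using assms by (simp add: real_FPdim_square)
  also have "\<dots> = real (radicand b * (square_part (FPdim_square b))\<^sup>2)"
    unfolding radicand_def by (rule arg_cong[OF squarefree_decompose])
  also have "\<dots> = (real (square_part (FPdim_square b)) * sqrt (real (radicand b)))\<^sup>2"
    by (simp add: power_mult_distrib)
  finally have "(d b)\<^sup>2 = (real (square_part (FPdim_square b)) * sqrt (real (radicand b)))\<^sup>2" .
  then show ?thesis
    by (rule power2_eq_imp_eq) (use FPdim_pos[OF assms] in auto)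
qed

lemma radicand_one: "radicand \<one> = 1"
  by (simp add: radicand_def FPdim_square_def FPdim_one)

lemma radicand_star: "b \<in> B \<Longrightarrow> radicand (star b) = radicand b"
  by (simp add: radicand_def FPdim_square_def FPdim_star)

text \<open>
  All constituents of \<open>b c\<close> are linked to \<open>k\<close>, so that \<open>d b * d c\<close>, the sum of their
  dimensions, is \<open>r * d k\<close> with \<open>r\<close> rational. Squaring compares the square classes.
\<close>

lemma radicand_constituent:
  assumes b: "b \<in> B" and c: "c \<in> B" and k: "k \<in> B" "cf (b \<otimes> c) k \<noteq> 0"
  shows "radicand k = squarefree_part (radicand b * radicand c)"
proof -
  have kpos: "cf (b \<otimes> c) k > 0"
    using structure_constants_nonneg[OF b c k(1)] k(2) by simp
  define r where "r = (\<Sum>l\<in>B. real_of_int (cf (b \<otimes> c) l) * (d l / d k))"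
  have "real_of_int (cf (b \<otimes> c) l) * (d l / d k) \<in> \<rat>" if l: "l \<in> B" for l
  proof (cases "cf (b \<otimes> c) l = 0")
    case False
    then have "linked k l"
      using constituents_linked[OF b c k(1) l kpos] structure_constants_nonneg[OF b c l] by simp
    then have "d l / d k \<in> \<rat>"
      by (intro FPdim_ratio_rational[OF k(1)] r_into_rtranclp)
    then show ?thesis
      by (intro Rats_mult) auto
  qed simp
  then have r: "r \<in> \<rat>"
    unfolding r_def by (rule Rats_sum)
  have "d b * d c = (\<Sum>l\<in>B. real_of_int (cf (b \<otimes> c) l) * d l)"
    using FPdim_character b c by (simp add: positive_character_def)
  also have "\<dots> = r * d k"
    using FPdim_pos[OF k(1)] by (simp add: r_def sum_distrib_right)
  finally have "(d b * d c)\<^sup>2 = (r * d k)\<^sup>2"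
    by simp
  then have "(d b)\<^sup>2 * (d c)\<^sup>2 = r\<^sup>2 * (d k)\<^sup>2"
    by (simp only: power_mult_distrib)
  then have "real (FPdim_square b * FPdim_square c) = r\<^sup>2 * real (FPdim_square k)"
    using b c k by (simp add: real_FPdim_square)
  then have "radicand k = squarefree_part (FPdim_square b * FPdim_square c)"
    unfolding radicand_def using r FPdim_square_pos[OF b] FPdim_square_pos[OF c]
    by (intro squarefree_part_eq_if_rational_square_multiple[symmetric, of _ r]) simp_all
  also have "\<dots> = squarefree_part (radicand b * FPdim_square c)"
    unfolding radicand_def using FPdim_square_pos[OF b]
    by (rule squarefree_part_mult_left[symmetric])
  also have "\<dots> = squarefree_part (radicand b * radicand c)"
    using squarefree_part_mult_left[OF FPdim_square_pos[OF c], of "radicand b"]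
    by (simp add: radicand_def mult.commute)
  finally show ?thesis .
qed

definition radicand_group :: "nat monoid"
  where "radicand_group = \<lparr>carrier = radicand ` B, monoid.mult = (\<lambda>m n. squarefree_part (m * n)), one = 1\<rparr>"

lemma radicand_pos: "radicand b > 0"
  unfolding radicand_def by (intro gr0I) simp

lemma radicand_group_simps:
  "carrier radicand_group = radicand ` B"
  "m \<otimes>\<^bsub>radicand_group\<^esub> n = squarefree_part (m * n)"
  "\<one>\<^bsub>radicand_group\<^esub> = 1"
  by (simp_all add: radicand_group_def)

text \<open>
  Closure comes from the ring: the squarefree part is the radicand of a constituent of a product.
\<close>

lemma radicand_group_closed:
  assumes "m \<in> radicand ` B" "n \<in> radicand ` B"
  shows "squarefree_part (m * n) \<in> radicand ` B"
proof -
  obtain b c where bc: "b \<in> B" "c \<in> B" "m = radicand b" "n = radicand c"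
    using assms by blast
  obtain k where "k \<in> B" "cf (b \<otimes> c) k > 0"
    using product_has_constituent[OF bc(1,2)] by blast
  then show ?thesis
    using radicand_constituent[OF bc(1,2), of k] bc(3,4) by (intro image_eqI[of _ _ k]) simp_all
qed

lemma radicand_square: "squarefree_part (radicand b * radicand b) = 1"
  using squarefree_part_square_mult[OF radicand_pos, of b 1] by (simp add: power2_eq_square)

lemma comm_group_radicand: "comm_group radicand_group"
proof (rule comm_groupI, unfold radicand_group_simps)
  show "1 \<in> radicand ` B"
    using imageI[OF one_basic, of radicand] by (simp add: radicand_one)
next
  fix x y z assume "x \<in> radicand ` B" "y \<in> radicand ` B" "z \<in> radicand ` B"
  then have pos: "x > 0" "y > 0" "z > 0"
    using radicand_pos by auto
  have "squarefree_part (squarefree_part (x * y) * z) = squarefree_part (x * y * z)"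
    using pos by (intro squarefree_part_mult_left) simp
  also have "\<dots> = squarefree_part (squarefree_part (y * z) * x)"
    using pos squarefree_part_mult_left[of "y * z" x] by (simp add: mult_ac)
  finally show "squarefree_part (squarefree_part (x * y) * z)
      = squarefree_part (x * squarefree_part (y * z))"
    by (simp add: mult.commute)
next
  fix x assume "x \<in> radicand ` B"
  then obtain b where b: "b \<in> B" "x = radicand b"
    by blast
  show "squarefree_part (1 * x) = x"
    using squarefree_part_mult_left[OF FPdim_square_pos[OF b(1)], of 1] b(2)
    by (simp add: radicand_def)
  show "\<exists>y\<in>radicand ` B. squarefree_part (y * x) = 1"
    using b radicand_square by blast
qed (simp_all add: radicand_group_closed mult.commute)

lemma radicand_grading:
  "faithful_grading R B star radicand_group (\<lambda>n. {b \<in> B. radicand b = n})"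
proof -
  interpret E: comm_group radicand_group
    by (rule comm_group_radicand)
  have "is_grading R B star radicand_group (\<lambda>n. {b \<in> B. radicand b = n})"
  proof (rule grading_by_degree[OF E.is_group])
    show "finite (carrier radicand_group)"
      using finite_basis by (simp add: radicand_group_simps)
    show "radicand b \<in> carrier radicand_group" if "b \<in> B" for b
      using that by (simp add: radicand_group_simps)
    show "radicand (star b) = inv\<^bsub>radicand_group\<^esub> radicand b" if "b \<in> B" for b
      using that radicand_star[OF that] radicand_square[of b]
      by (intro E.inv_equality[symmetric]) (simp_all add: radicand_group_simps)
  qed (simp add: radicand_group_simps radicand_constituent)
  moreover have "int_span R {b \<in> B. radicand b = n} \<noteq> {\<zero>}" if "n \<in> carrier radicand_group" for n
  proof -
    obtain b where b: "b \<in> B" "radicand b = n"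
      using \<open>n \<in> carrier radicand_group\<close> by (auto simp: radicand_group_simps)
    then have "b \<in> int_span R {b \<in> B. radicand b = n}"
      by (subst int_span_iff) (auto simp: coord_basic)
    then show ?thesis
      using basic_nonzero[OF b(1)] by auto
  qed
  ultimately show ?thesis
    by (simp add: faithful_grading_def)
qed

lemma FPdim_span:
  assumes "y \<in> int_span R {b \<in> B. radicand b = n}"
  shows "\<exists>m :: int. d y = of_int m * sqrt (real n)"
proof -
  have y: "y \<in> carrier R" "\<And>b. b \<in> B \<Longrightarrow> radicand b \<noteq> n \<Longrightarrow> cf y b = 0"
    using assms by (auto simp: int_span_iff)
  have "d y = (\<Sum>b\<in>B. of_int (cf y b) * d b)"
    using y(1) by (rule additive_expand[OF FPdim_additive])
  also have "\<dots> = (\<Sum>b\<in>B. of_int (cf y b * int (square_part (FPdim_square b))) * sqrt (real n))"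
  proof (rule sum.cong)
    fix b assume b: "b \<in> B"
    show "of_int (cf y b) * d b = of_int (cf y b * int (square_part (FPdim_square b))) * sqrt (real n)"
      using y(2)[OF b] FPdim_basic_eq[OF b] by (cases "radicand b = n") simp_all
  qed simp
  also have "\<dots> = of_int (\<Sum>b\<in>B. cf y b * int (square_part (FPdim_square b))) * sqrt (real n)"
    by (simp add: sum_distrib_right)
  finally show ?thesis by blast
qed

end

theorem theorem3p10:
  fixes R :: "('a, 'm) ring_scheme" and B :: "'a set" and star :: "'a \<Rightarrow> 'a"
  assumes "based_ring R B star"
    and "FPdim_ring R B \<in> \<int>"
  shows "\<exists>(E :: nat monoid) (n :: nat \<Rightarrow> nat) (C :: nat \<Rightarrow> 'a set).
    elementary_abelian_2_group E \<and>
    inj_on n (carrier E) \<and>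
    (\<forall>x\<in>carrier E. n x > 0 \<and> squarefree (n x)) \<and>
    n \<one>\<^bsub>E\<^esub> = 1 \<and>
    faithful_grading R B star E C \<and>
    (\<forall>x\<in>carrier E. \<forall>y\<in>int_span R (C x). \<exists>m :: int.
      FPdim R B y = of_int m * sqrt (real (n x)))"
proof -
  interpret integral_based_ring R B star
    using assms by (simp add: integral_based_ring_def integral_based_ring_axioms_def)
  have group: "elementary_abelian_2_group radicand_group"
    using comm_group_radicand radicand_square
    by (auto simp: elementary_abelian_2_group_def radicand_group_simps)
  have squarefree: "\<forall>x\<in>carrier radicand_group. id x > 0 \<and> squarefree (id x)"
    using radicand_pos by (auto simp: radicand_group_simps radicand_def)
  have one: "id \<one>\<^bsub>radicand_group\<^esub> = 1"
    by (simp add: radicand_group_simps)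
  have dims: "\<forall>x\<in>carrier radicand_group. \<forall>y\<in>int_span R {b \<in> B. radicand b = x}.
      \<exists>m :: int. FPdim R B y = of_int m * sqrt (real (id x))"
    using FPdim_span by simp
  show ?thesis
    by (intro exI[of _ radicand_group] exI[of _ id] exI[of _ "\<lambda>n. {b \<in> B. radicand b = n}"]
        conjI group inj_on_id squarefree one radicand_grading dims)
qed

end
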